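(* For a plane triangle with side lengths $a,b,c$, area $A$ and quadrofactor $q=\dfrac{a^4+b^4+c^4}{(a^2+b^2+c^2)^2}$, the normalized area equals $$\frac{4\sqrt3\,A}{a^2+b^2+c^2}=\sqrt{3-6q}.$$
   Context: A plane triangle is a triple $(z_1,z_2,z_3)$ of points of $\mathbb C$ that is non-singular, i.e. not $z_1=z_2=z_3$ (collinear points are allowed). Its sides are $a=|z_1-z_2|$, $b=|z_2-z_3|$, $c=|z_3-z_1|$. The number $\frac{4\sqrt3A}{a^2+b^2+c^2}$, with $A$ the (unsigned) area of the triangle, is called its normalized area. *)

theory Defs
  imports "HOL-Analysis.Analysis"
begin

text \<open>
  Degenerate triangles (collinear points, or exactly two coinciding vertices) are allowed;
  only triples with all three vertices equal are excluded.
\<close>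
definition plane_triangle :: "complex \<Rightarrow> complex \<Rightarrow> complex \<Rightarrow> bool" where
  "plane_triangle z1 z2 z3 \<longleftrightarrow> \<not> (z1 = z2 \<and> z2 = z3)"

definition triangle_area :: "complex \<Rightarrow> complex \<Rightarrow> complex \<Rightarrow> real" where
  "triangle_area z1 z2 z3 = measure lborel (convex hull {z1, z2, z3})"

definition normalized_area :: "complex \<Rightarrow> complex \<Rightarrow> complex \<Rightarrow> real" where
  "normalized_area z1 z2 z3 =
     4 * sqrt 3 * triangle_area z1 z2 z3 /
       ((cmod (z1 - z2))\<^sup>2 + (cmod (z2 - z3))\<^sup>2 + (cmod (z3 - z1))\<^sup>2)"

definition quadrofactor :: "real \<Rightarrow> real \<Rightarrow> real \<Rightarrow> real" where
  "quadrofactor a b c = (a ^ 4 + b ^ 4 + c ^ 4) / (a\<^sup>2 + b\<^sup>2 + c\<^sup>2)\<^sup>2"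

end

theory Submission
  imports Defs
begin

text \<open>
  The statement is Heron's formula in homogeneous form.  Expanding the four factors of Heron's
  product shows that \<open>16 A\<^sup>2 = (a\<^sup>2 + b\<^sup>2 + c\<^sup>2)\<^sup>2 - 2 (a\<^sup>4 + b\<^sup>4 + c\<^sup>4)\<close>; multiplying by \<open>3\<close>, dividing
  by \<open>(a\<^sup>2 + b\<^sup>2 + c\<^sup>2)\<^sup>2\<close> and taking roots gives \<open>sqrt (3 - 6 q)\<close>.  Non-singularity of the triangle
  is what makes the divisor nonzero.

  The area is a Lebesgue measure on the complex plane, whereas the library theorem \<open>heron\<close> speaks
  about the measure on \<open>real ^ 2\<close>.  The two are matched by the lemma
  \<open>lborel_complex_eq_distr_vec2\<close>: the coordinate map \<open>(x, y) \<mapsto> x + i y\<close> pushes the measure of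
  \<open>real ^ 2\<close> forward to that of the complex plane.  Since its inverse is linear and isometric,
  convex hulls and side lengths carry over as well, so \<open>heron\<close> applies to complex triangles.
\<close>

definition vec2_of_complex :: "complex \<Rightarrow> real ^ 2" where
  "vec2_of_complex z = vector [Re z, Im z]"

definition complex_of_vec2 :: "real ^ 2 \<Rightarrow> complex" where
  "complex_of_vec2 v = Complex (v $ 1) (v $ 2)"

lemma vec2_of_complex_nth [simp]:
  "vec2_of_complex z $ 1 = Re z" "vec2_of_complex z $ 2 = Im z"
  by (simp_all add: vec2_of_complex_def)

lemma complex_of_vec2_sel [simp]:
  "Re (complex_of_vec2 v) = v $ 1" "Im (complex_of_vec2 v) = v $ 2"
  by (simp_all add: complex_of_vec2_def)

lemma vec2_of_complex_inverse [simp]: "complex_of_vec2 (vec2_of_complex z) = z"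
  by (simp add: complex_eq_iff)

lemma complex_of_vec2_inverse [simp]: "vec2_of_complex (complex_of_vec2 v) = v"
  by (simp add: vec_eq_iff forall_2)

lemma linear_vec2_of_complex: "linear vec2_of_complex"
  by (rule linearI) (simp_all add: vec_eq_iff forall_2)

lemma linear_complex_of_vec2: "linear complex_of_vec2"
  by (rule linearI) (simp_all add: complex_eq_iff)

lemma dist_vec2_of_complex: "dist (vec2_of_complex z) (vec2_of_complex w) = cmod (z - w)"
  by (simp add: dist_vec_def L2_set_def sum_2 dist_real_def cmod_def)

lemma borel_measurable_complex_of_vec2 [measurable]: "complex_of_vec2 \<in> borel_measurable borel"
  by (intro borel_measurable_continuous_onI linear_continuous_on)
     (simp add: linear_complex_of_vec2 linear_conv_bounded_linear [symmetric])

lemma vimage_complex_of_vec2: "complex_of_vec2 -` S = vec2_of_complex ` S"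
  by force

text \<open>
  Lebesgue measure is determined by its values on boxes, and the coordinate map matches the boxes
  of the two spaces together with their side lengths.
\<close>
lemma lborel_complex_eq_distr_vec2:
  "(lborel :: complex measure) = distr lborel borel complex_of_vec2"
proof (rule lborel_eqI)
  fix l u :: complex
  assume le: "\<And>b. b \<in> Basis \<Longrightarrow> l \<bullet> b \<le> u \<bullet> b"
  have le': "Re l \<le> Re u" "Im l \<le> Im u"
    using le [of 1] le [of \<i>] by (simp_all add: Basis_complex_def)
  have basis: "(Basis :: (real ^ 2) set) = {axis 1 1, axis 2 1}"
    by (auto simp: Basis_vec_def UNIV_2)
  have ne: "axis 1 1 \<noteq> (axis 2 1 :: real ^ 2)"
    by (simp add: axis_eq_axis)
  have "complex_of_vec2 -` box l u = box (vec2_of_complex l) (vec2_of_complex u)"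
    by (auto simp: box_def basis Basis_complex_def inner_axis)
  then have "emeasure (distr lborel borel complex_of_vec2) (box l u) =
      emeasure lborel (box (vec2_of_complex l) (vec2_of_complex u))"
    by (simp add: emeasure_distr)
  also have "\<dots> = ennreal ((Re u - Re l) * (Im u - Im l))"
    using le' ne by (subst emeasure_lborel_box) (auto simp: basis inner_axis algebra_simps)
  also have "\<dots> = ennreal (\<Prod>b\<in>Basis. (u - l) \<bullet> b)"
    by (simp add: Basis_complex_def)
  finally show "emeasure (distr lborel borel complex_of_vec2) (box l u) =
      ennreal (\<Prod>b\<in>Basis. (u - l) \<bullet> b)" .
qed simp

lemma triangle_area_eq_measure_vec2:
  "triangle_area z1 z2 z3 =
     measure lborel (convex hull {vec2_of_complex z1, vec2_of_complex z2, vec2_of_complex z3})"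
proof -
  have "compact (convex hull {z1, z2, z3})"
    by (intro finite_imp_compact_convex_hull) auto
  then have "convex hull {z1, z2, z3} \<in> sets borel"
    by (intro borel_closed compact_imp_closed)
  then have "triangle_area z1 z2 z3 =
      measure lborel (vec2_of_complex ` (convex hull {z1, z2, z3}))"
    unfolding triangle_area_def
    by (subst lborel_complex_eq_distr_vec2) (simp add: measure_distr vimage_complex_of_vec2)
  also have "vec2_of_complex ` (convex hull {z1, z2, z3}) =
      convex hull (vec2_of_complex ` {z1, z2, z3})"
    by (rule convex_hull_linear_image [OF linear_vec2_of_complex])
  finally show ?thesis
    by simp
qed

text \<open>
  The four linear factors of Heron's product multiply out to a polynomial in the squares of the
  sides, which are also the variables in which the quadrofactor is written.
\<close>
lemma triangle_area_quadratic_form: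
  fixes z1 z2 z3 :: complex
  defines "a \<equiv> cmod (z1 - z2)" and "b \<equiv> cmod (z2 - z3)" and "c \<equiv> cmod (z3 - z1)"
  shows "4 * triangle_area z1 z2 z3 =
    sqrt ((a\<^sup>2 + b\<^sup>2 + c\<^sup>2)\<^sup>2 - 2 * (a ^ 4 + b ^ 4 + c ^ 4))"
proof -
  define s where "s = (a + b + c) / 2"
  have "triangle_area z1 z2 z3 = sqrt (s * (s - b) * (s - c) * (s - a))"
    unfolding triangle_area_eq_measure_vec2 heron dist_vec2_of_complex
    by (simp add: s_def a_def b_def c_def norm_minus_commute add_ac)
  then have "4 * triangle_area z1 z2 z3 = sqrt (16 * (s * (s - b) * (s - c) * (s - a)))"
    by (simp add: real_sqrt_mult)
  also have "16 * (s * (s - b) * (s - c) * (s - a)) =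
      (a\<^sup>2 + b\<^sup>2 + c\<^sup>2)\<^sup>2 - 2 * (a ^ 4 + b ^ 4 + c ^ 4)"
    by (simp add: s_def field_simps power2_eq_square power4_eq_xxxx)
  finally show ?thesis .
qed

theorem theorem5:
  fixes z1 z2 z3 :: complex and a b c :: real
  assumes "plane_triangle z1 z2 z3"
    and "a = cmod (z1 - z2)" and "b = cmod (z2 - z3)" and "c = cmod (z3 - z1)"
  shows "normalized_area z1 z2 z3 = sqrt (3 - 6 * quadrofactor a b c)"
proof -
  define S where "S = a\<^sup>2 + b\<^sup>2 + c\<^sup>2"
  define Q where "Q = a ^ 4 + b ^ 4 + c ^ 4"
  have "a \<noteq> 0 \<or> b \<noteq> 0"
    using assms by (auto simp: plane_triangle_def)
  then have "S > 0"
    unfolding S_def by (auto simp: add_pos_nonneg add_nonneg_pos)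
  have "normalized_area z1 z2 z3 = sqrt 3 * (4 * triangle_area z1 z2 z3) / S"
    by (simp add: normalized_area_def S_def assms)
  also have "4 * triangle_area z1 z2 z3 = sqrt (S\<^sup>2 - 2 * Q)"
    unfolding S_def Q_def assms(2-4) by (rule triangle_area_quadratic_form)
  also have "sqrt 3 * sqrt (S\<^sup>2 - 2 * Q) / S = sqrt (3 * (S\<^sup>2 - 2 * Q) / S\<^sup>2)"
    using \<open>S > 0\<close> by (simp add: real_sqrt_mult real_sqrt_divide del: right_diff_distrib_numeral)
  also have "3 * (S\<^sup>2 - 2 * Q) / S\<^sup>2 = 3 - 6 * (Q / S\<^sup>2)"
    using \<open>S > 0\<close> by (simp add: field_simps)
  also have "Q / S\<^sup>2 = quadrofactor a b c"
    by (simp add: quadrofactor_def S_def Q_def)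
  finally show ?thesis .
qed

end
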